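(* Suppose $2\leq k\leq n$ are integers and $f:V(P_n)\to\{1,\ldots,k\}$ is a $k$-color weak maximizer of $W$ on $P_n$. Then: (1) $W(f)=\min\{W(f') : f'\in\mathrm{WM}_k(P_n)\}$ if and only if the numbers of vertices in any two color classes of $f$ differ by at most one; and (2) $W(f)=\max\{W(f') : f'\in\mathrm{WM}_k(P_n)\}$ if and only if $f$ has a color class of the largest possible size $n-(k-1)$.
   Context: $P_n$ is the path on $n$ vertices. For a finite simple connected graph $G$ and $A\subseteq V(G)$, $W(A)=\sum_{\{u,v\}\in\binom{A}{2}}d_G(u,v)$, with $d_G$ the shortest-path distance. A $k$-coloring of $G$ is any function $f:V(G)\to\{1,\ldots,k\}$; its color classes are the sets $f^{-1}(i)$, $1\leq i\leq k$; $\mathrm{type}(f)$ is the $k$-tuple of the cardinalities $|f^{-1}(1)|,\ldots,|f^{-1}(k)|$ arranged in non-decreasing order, and $W(f)=\sum_{i=1}^k W(f^{-1}(i))$. For $k\geq 2$, $f$ is a $k$-color weak maximizer of $W$ on $G$ if $f$ is surjective and $W(f)\geq W(f')$ for all surjective $f':V(G)\to\{1,\ldots,k\}$ with $\mathrm{type}(f')=\mathrm{type}(f)$. $\mathrm{WM}_k(G)$ is the set of all $k$-color weak maximizers of $W$ on $G$. *)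

theory Defs
  imports "Graph_Theory.Graph_Theory" "HOL-Library.FuncSet"
begin

text \<open>
  Finite simple undirected graphs are the \<open>pair_graph\<close>s of the library, i.e. symmetric,
  loop-free sets of pairs over a finite vertex set. The vertices of the path are numbered from 1.
\<close>

definition path_graph :: "nat \<Rightarrow> nat pair_pre_digraph" where
  "path_graph n =
     \<lparr> pverts = {1..n},
       parcs = {(u, v). u \<in> {1..n} \<and> v \<in> {1..n} \<and> (v = Suc u \<or> u = Suc v)} \<rparr>"

lemma pair_graph_path_graph: "pair_graph (path_graph n)"
proof -
  have fin: "finite (parcs (path_graph n))"
    by (rule finite_subset[of _ "{1..n} \<times> {1..n}"]) (auto simp: path_graph_def)
  show ?thesis
    by unfold_locales
      (use fin in \<open>auto simp: path_graph_def symmetric_def sym_def with_proj_def arcs_ends_conv\<close>)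
qed

text \<open>
  The library's shortest-path value for unit arc costs. It is an \<open>ereal\<close>, finite for vertices of
  a connected graph; \<open>real_of_ereal\<close> would send an infinite distance to 0.
\<close>

definition graph_dist :: "'a pair_pre_digraph \<Rightarrow> 'a \<Rightarrow> 'a \<Rightarrow> real" where
  "graph_dist G u v = real_of_ereal (wf_digraph.\<mu> (with_proj G) (\<lambda>_. 1) u v)"

text \<open>
  The sum ranges over the 2-element subsets of \<open>A\<close>; the description is well defined because
  \<open>graph_dist\<close> is symmetric on undirected graphs.
\<close>

definition wiener :: "'a pair_pre_digraph \<Rightarrow> 'a set \<Rightarrow> real" where
  "wiener G A =
     (\<Sum>e \<in> {e. e \<subseteq> A \<and> card e = 2}. THE d. \<exists>u v. e = {u, v} \<and> d = graph_dist G u v)"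

text \<open>
  Colorings are extensional functions, so that functions on the vertex set are not counted
  several times and the set of all \<open>k\<close>-colorings is finite.
\<close>

definition colorings :: "nat \<Rightarrow> 'a pair_pre_digraph \<Rightarrow> ('a \<Rightarrow> nat) set" where
  "colorings k G = pverts G \<rightarrow>\<^sub>E {1..k}"

definition surj_colorings :: "nat \<Rightarrow> 'a pair_pre_digraph \<Rightarrow> ('a \<Rightarrow> nat) set" where
  "surj_colorings k G = {f \<in> colorings k G. f ` pverts G = {1..k}}"

definition color_class :: "'a pair_pre_digraph \<Rightarrow> ('a \<Rightarrow> nat) \<Rightarrow> nat \<Rightarrow> 'a set" where
  "color_class G f i = {v \<in> pverts G. f v = i}"

definition coloring_type :: "nat \<Rightarrow> 'a pair_pre_digraph \<Rightarrow> ('a \<Rightarrow> nat) \<Rightarrow> nat list" where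
  "coloring_type k G f = sort (map (\<lambda>i. card (color_class G f i)) [1..<Suc k])"

definition coloring_wiener :: "nat \<Rightarrow> 'a pair_pre_digraph \<Rightarrow> ('a \<Rightarrow> nat) \<Rightarrow> real" where
  "coloring_wiener k G f = (\<Sum>i = 1..k. wiener G (color_class G f i))"

definition weak_maximizers :: "nat \<Rightarrow> 'a pair_pre_digraph \<Rightarrow> ('a \<Rightarrow> nat) set" where
  "weak_maximizers k G =
     {f \<in> surj_colorings k G.
        \<forall>f' \<in> surj_colorings k G.
          coloring_type k G f' = coloring_type k G f \<longrightarrow>
            coloring_wiener k G f' \<le> coloring_wiener k G f}"

text \<open>Hence \<open>Min\<close> and \<open>Max\<close> over the weak maximizers are genuine extrema.\<close>

lemma finite_weak_maximizers: "finite (pverts G) \<Longrightarrow> finite (weak_maximizers k G)"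
  unfolding weak_maximizers_def surj_colorings_def colorings_def
  by (simp add: finite_PiE)

end

theory Submission
  imports Defs
begin

text \<open>
  On a path the Wiener sum of a vertex set \<open>A\<close> can be counted edge by edge: deleting an edge
  splits \<open>A\<close> into a left and a right part, the edge is used by exactly the pairs that it
  separates, and so \<open>W(A)\<close> is the sum over the edges of (left part) times (right part)
  (\<open>wiener_path_cuts\<close>). This turns a comparison of colorings into a comparison at each edge.

  The heart of the proof is a statement about two color classes of sizes \<open>p \<ge> q \<ge> 1\<close>
  (\<open>wiener_spread\<close>): their union can be split anew into sets of sizes \<open>p + 1\<close> and
  \<open>q - 1\<close> so that the sum of the two Wiener values strictly increases. If \<open>x\<close> and
  \<open>y\<close> elements of the two classes lie to the left of an edge, then only \<open>x + y\<close> is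
  determined by the union, and the contribution of the edge depends on the class difference
  \<open>D = x - y\<close> through the parabola \<open>D (d - D)\<close> with \<open>d = p - q\<close>. Passing to
  sizes \<open>p + 1\<close>, \<open>q - 1\<close> replaces it by the higher parabola \<open>E (d + 2 - E)\<close>.
  The new split lets \<open>E\<close> climb to the top of that parabola as fast as possible, keeps it there
  by alternating the two classes, and descends on the other side as late as possible; hence it is at
  least as good as every split with sizes \<open>p\<close>, \<open>q\<close> at every edge, and strictly better
  just after the first vertex.

  Consequently, moving a vertex from a class of size at least 2 to one that is at least as large
  raises the optimal value (\<open>spread_increases_wiener\<close>), and the reverse step, applied to classes whose
  sizes differ by at least 2, lowers it (\<open>level_decreases_wiener\<close>). So a weak maximizer of
  largest value has at most one class with more than one vertex, and one of smallest value is balanced.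
  Each of these two conditions determines the type, and weak maximizers of equal type have equal
  value, which gives the converse implications.
\<close>

section \<open>Distances and Wiener sums on a path\<close>

lemma path_graph_simps [simp]:
  "pverts (path_graph n) = {1..n}"
  "(u, v) \<in> parcs (path_graph n) \<longleftrightarrow>
     u \<in> {1..n} \<and> v \<in> {1..n} \<and> (v = Suc u \<or> u = Suc v)"
  by (auto simp: path_graph_def)

text \<open>Each step of a walk changes the vertex number by one.\<close>

lemma path_walk_length:
  assumes "pre_digraph.awalk (with_proj (path_graph n)) u p v"
  shows "\<bar>real u - real v\<bar> \<le> real (length p)"
proof -
  interpret pair_graph "path_graph n" by (rule pair_graph_path_graph)
  show ?thesis using assms
  proof (induction p arbitrary: u)
    case Nil
    then show ?case by (simp add: awalk_Nil_iff)
  next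
    case (Cons e p)
    obtain w where e: "e = (u, w)" "w = Suc u \<or> u = Suc w"
      and walk: "pre_digraph.awalk (with_proj (path_graph n)) w p v"
      using Cons.prems by (cases e) (auto simp: awalk_Cons_iff)
    show ?case using Cons.IH[OF walk] e(2) by auto
  qed
qed

lemma path_walk_exists:
  assumes "1 \<le> u" "u + d \<le> n"
  shows "\<exists>p. pre_digraph.awalk (with_proj (path_graph n)) u p (u + d) \<and> length p = d"
    and "\<exists>p. pre_digraph.awalk (with_proj (path_graph n)) (u + d) p u \<and> length p = d"
proof -
  interpret pair_graph "path_graph n" by (rule pair_graph_path_graph)
  show "\<exists>p. awalk u p (u + d) \<and> length p = d"
    using assms
  proof (induction d arbitrary: u)
    case 0
    then have "awalk u [] u" by (simp add: awalk_Nil_iff)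
    then show ?case by auto
  next
    case (Suc d)
    obtain p where p: "awalk (Suc u) p (Suc u + d)" "length p = d"
      using Suc.IH[of "Suc u"] Suc.prems by auto
    have "awalk u ((u, Suc u) # p) (u + Suc d)"
      using p Suc.prems by (simp add: awalk_Cons_iff)
    with p show ?case by (intro exI[of _ "(u, Suc u) # p"]) auto
  qed
  show "\<exists>p. awalk (u + d) p u \<and> length p = d"
    using assms
  proof (induction d)
    case 0
    then have "awalk u [] u" by (simp add: awalk_Nil_iff)
    then show ?case by auto
  next
    case (Suc d)
    obtain p where p: "awalk (u + d) p u" "length p = d"
      using Suc.IH Suc.prems by auto
    have "awalk (u + Suc d) ((u + Suc d, u + d) # p) u"
      using p Suc.prems by (simp add: awalk_Cons_iff)
    with p show ?case by (intro exI[of _ "(u + Suc d, u + d) # p"]) auto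
  qed
qed

lemma graph_dist_path:
  assumes "u \<in> {1..n}" "v \<in> {1..n}"
  shows "graph_dist (path_graph n) u v = \<bar>real u - real v\<bar>"
proof -
  interpret pair_graph "path_graph n" by (rule pair_graph_path_graph)
  have cost: "awalk_cost (\<lambda>_. 1) p = real (length p)" for p :: "(nat \<times> nat) list"
    by (induction p) auto
  have "\<exists>p. awalk u p v \<and> real (length p) = \<bar>real u - real v\<bar>"
  proof (cases "u \<le> v")
    case True
    then show ?thesis using path_walk_exists(1)[of u "v - u" n] assms by auto
  next
    case False
    then show ?thesis using path_walk_exists(2)[of v "u - v" n] assms by auto
  qed
  then obtain p where p: "awalk u p v" "real (length p) = \<bar>real u - real v\<bar>" by blast
  have "\<mu> (\<lambda>_. 1) u v = ereal \<bar>real u - real v\<bar>"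
  proof (rule antisym)
    show "\<mu> (\<lambda>_. 1) u v \<le> ereal \<bar>real u - real v\<bar>"
      using min_cost_le_walk_cost[OF p(1), of "\<lambda>_. 1"] p(2) by (simp add: cost)
    show "ereal \<bar>real u - real v\<bar> \<le> \<mu> (\<lambda>_. 1) u v"
      unfolding \<mu>_def by (rule INF_greatest) (auto simp: cost intro: path_walk_length)
  qed
  then show ?thesis by (simp add: graph_dist_def)
qed

lemma wiener_path_pairs:
  assumes "A \<subseteq> {1..n}"
  shows "wiener (path_graph n) A = (\<Sum>(u, v) \<in> {(u, v). u \<in> A \<and> v \<in> A \<and> u < v}. real (v - u))"
proof -
  let ?P = "{(u, v). u \<in> A \<and> v \<in> A \<and> u < v}"
  let ?d = "\<lambda>e. THE d. \<exists>u v. e = {u, v} \<and> d = graph_dist (path_graph n) u v"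
  have bij: "bij_betw (\<lambda>(u, v). {u, v}) ?P {e. e \<subseteq> A \<and> card e = 2}"
    unfolding bij_betw_def
  proof
    show "inj_on (\<lambda>(u, v). {u, v}) ?P" by (auto simp: inj_on_def doubleton_eq_iff)
    show "(\<lambda>(u, v). {u, v}) ` ?P = {e. e \<subseteq> A \<and> card e = 2}"
    proof (intro equalityI subsetI)
      fix e assume "e \<in> {e. e \<subseteq> A \<and> card e = 2}"
      then obtain x y where "e = {x, y}" "x \<noteq> y" "e \<subseteq> A" by (auto simp: card_2_iff)
      then show "e \<in> (\<lambda>(u, v). {u, v}) ` ?P"
        by (cases "x < y") (auto intro: image_eqI[of _ _ "(x, y)"] image_eqI[of _ _ "(y, x)"])
    qed auto
  qed
  have d: "?d {u, v} = real (v - u)" if uv: "u \<in> A" "v \<in> A" "u < v" for u v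
  proof (rule the_equality)
    have dist: "graph_dist (path_graph n) u v = real (v - u)"
        "graph_dist (path_graph n) v u = real (v - u)"
      using graph_dist_path[of u n v] graph_dist_path[of v n u] uv
        subsetD[OF assms, of u] subsetD[OF assms, of v] by auto
    show "\<exists>u' v'. {u, v} = {u', v'} \<and> real (v - u) = graph_dist (path_graph n) u' v'"
      using dist by (intro exI[of _ u] exI[of _ v]) simp
    fix d assume "\<exists>u' v'. {u, v} = {u', v'} \<and> d = graph_dist (path_graph n) u' v'"
    then show "d = real (v - u)"
      using dist by (auto simp: doubleton_eq_iff)
  qed
  show ?thesis
    unfolding wiener_def
    by (subst sum.reindex_bij_betw[OF bij, symmetric]) (auto intro!: sum.cong d)
qed

definition cut :: "nat set \<Rightarrow> nat \<Rightarrow> nat" where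
  "cut A t = card (A \<inter> {..<t}) * card (A \<inter> {t..})"

text \<open>
  A pair \<open>u < v\<close> has distance \<open>v - u\<close>, the number of \<open>t\<close> with
  \<open>u < t \<le> v\<close>; exchanging the two summations counts, for each \<open>t\<close>, the pairs that
  it separates. The summand \<open>t\<close> belongs to the edge from \<open>t - 1\<close> to \<open>t\<close>, and the
  summands for \<open>t = 0\<close> and \<open>t = 1\<close> vanish.
\<close>

lemma wiener_path_cuts:
  assumes "A \<subseteq> {1..n}"
  shows "wiener (path_graph n) A = real (\<Sum>t\<le>n. cut A t)"
proof -
  let ?P = "{(u, v). u \<in> A \<and> v \<in> A \<and> u < v}"
  have finA: "finite A" using assms finite_subset by blast
  have finP: "finite ?P" by (rule finite_subset[of _ "A \<times> A"]) (use finA in auto)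
  have "(\<Sum>(u, v)\<in>?P. v - u) = (\<Sum>(u, v)\<in>?P. \<Sum>t\<le>n. of_bool (u < t \<and> t \<le> v))"
  proof (rule sum.cong[OF refl], clarify)
    fix u v assume "u \<in> A" "v \<in> A" "u < v"
    then have "{t. t \<le> n \<and> u < t \<and> t \<le> v} = {u<..v}" using assms by auto
    then show "v - u = (\<Sum>t\<le>n. of_bool (u < t \<and> t \<le> v))"
      by (simp add: Collect_conj_eq[symmetric] atMost_def Int_def)
  qed
  also have "\<dots> = (\<Sum>t\<le>n. \<Sum>(u, v)\<in>?P. of_bool (u < t \<and> t \<le> v))"
    unfolding case_prod_unfold by (rule sum.swap)
  also have "\<dots> = (\<Sum>t\<le>n. cut A t)"
  proof (rule sum.cong[OF refl])
    fix t
    have "?P \<inter> {z. fst z < t \<and> t \<le> snd z} = (A \<inter> {..<t}) \<times> (A \<inter> {t..})" by auto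
    then show "(\<Sum>(u, v)\<in>?P. of_bool (u < t \<and> t \<le> v)) = cut A t"
      using finP by (simp add: case_prod_unfold cut_def card_cartesian_product)
  qed
  finally show ?thesis
    unfolding wiener_path_pairs[OF assms] by (simp only: of_nat_sum case_prod_unfold flip: of_nat_sum)
qed

section \<open>Making two classes more unequal\<close>

text \<open>
  A subset of \<open>Y\<close> can be prescribed by saying how many of the first \<open>s\<close> elements of
  \<open>Y\<close> it contains: put an element into the subset exactly when the prescribed count
  \<open>\<beta>\<close> jumps there.
\<close>

lemma realize_profile:
  fixes Y :: "nat set" and \<beta> :: "nat \<Rightarrow> nat"
  assumes "\<beta> 0 = 0" and step: "\<And>s. \<beta> (Suc s) = \<beta> s \<or> \<beta> (Suc s) = Suc (\<beta> s)"
  obtains B where "B \<subseteq> Y" "\<And>t. card (B \<inter> {..<t}) = \<beta> (card (Y \<inter> {..<t}))"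
proof
  let ?B = "{v \<in> Y. \<beta> (Suc (card (Y \<inter> {..<v}))) = Suc (\<beta> (card (Y \<inter> {..<v})))}"
  show "?B \<subseteq> Y" by auto
  fix t show "card (?B \<inter> {..<t}) = \<beta> (card (Y \<inter> {..<t}))"
  proof (induction t)
    case 0 then show ?case using assms by simp
  next
    case (Suc t)
    have ins: "X \<inter> {..<Suc t} = (if t \<in> X then insert t (X \<inter> {..<t}) else X \<inter> {..<t})" for X
      by (auto simp: less_Suc_eq)
    show ?case
      using Suc.IH step[of "card (Y \<inter> {..<t})"] unfolding ins[of Y] ins[of ?B] by auto
  qed
qed

text \<open>
  For a fixed number \<open>x + y\<close> of vertices on the left, the contribution of a cut to the two
  classes depends only on a parabola in the difference \<open>x - y\<close>.
\<close>

lemma two_class_value: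
  fixes x y p q :: int
  shows "2 * (x * (p - x) + y * (q - y))
      = (x + y) * (p + q - (x + y)) + (x - y) * (p - q - (x - y))"
  by (simp add: algebra_simps)

text \<open>
  On its ascending branch the parabola with roots \<open>0\<close> and \<open>d + 2\<close>, taken at the largest
  possible argument \<open>s\<close>, dominates the one with roots \<open>0\<close> and \<open>d\<close>. The vertex
  is at \<open>d / 2 + 1\<close>; the slack up to \<open>(d + 3) / 2\<close> is harmless for integers, since then
  every integer \<open>D < s\<close> is at least as far from the vertex as \<open>s\<close> is. For negative
  \<open>D\<close> the left-hand side is not positive.
\<close>

lemma parabola_mono:
  fixes d D s :: int
  assumes "0 \<le> d" "0 \<le> s" "D \<le> s" "2 * s \<le> d + 3"
  shows "D * (d - D) \<le> s * (d + 2 - s)"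
proof (cases "D < 0")
  case True
  then have "D * (d - D) \<le> 0" using assms by (intro mult_nonpos_nonneg) auto
  moreover have "0 \<le> s * (d + 2 - s)" using assms by (intro mult_nonneg_nonneg) auto
  ultimately show ?thesis by linarith
next
  case False
  have "0 \<le> (s - D) * (d + 2 - s - D)"
  proof (cases "D = s")
    case False then show ?thesis using assms by (intro mult_nonneg_nonneg) auto
  qed simp
  then show ?thesis using False by (simp add: algebra_simps)
qed

text \<open>
  Going from \<open>d\<close> to \<open>d + 2\<close> raises the top of the parabola from \<open>d\<^sup>2 / 4\<close> by
  \<open>d + 1\<close>, whereas an argument within distance 1 of the vertex loses at most 1.
\<close>

lemma parabola_middle:
  fixes d D e :: int
  assumes "0 \<le> d" "\<bar>2 * e - (d + 2)\<bar> \<le> 2"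
  shows "D * (d - D) \<le> e * (d + 2 - e)"
proof -
  have "\<bar>2 * e - (d + 2)\<bar>\<^sup>2 \<le> 2\<^sup>2" using assms(2) by (intro power_mono) auto
  then have "(2 * e - (d + 2))\<^sup>2 \<le> 4" by simp
  moreover have "0 \<le> (2 * D - d)\<^sup>2" by simp
  ultimately show ?thesis using assms(1) by (simp add: power2_eq_square algebra_simps)
qed

text \<open>
  The number of elements of the smaller new class among the first \<open>s\<close> elements. With \<open>m\<close>
  for half of the new size difference \<open>p - q + 2\<close>, rounded up, the first \<open>m\<close> elements go
  to the larger class, so that the class difference reaches the vertex of the parabola; then the
  classes alternate, starting with the smaller one, until its \<open>q - 1\<close> elements are used up; all
  remaining elements go to the larger class.
\<close>

definition profile :: "nat \<Rightarrow> nat \<Rightarrow> nat \<Rightarrow> nat" where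
  "profile p q s = min (q - 1) ((s + 1 - (p - q + 3) div 2) div 2)"

text \<open>
  By \<open>two_class_value\<close> this compares the two parabolas. Before the alternating stretch the new
  class difference is as large as possible and \<open>parabola_mono\<close> applies; within it
  \<open>parabola_middle\<close> applies; after it the situation is the mirror image of the first case, with
  the counts to the right of the cut in place of those to the left.
\<close>

lemma cut_profile:
  fixes p q x y :: nat
  defines "z \<equiv> profile p q (x + y)"
  assumes "q \<le> p" "1 \<le> q" "x \<le> p" "y \<le> q"
  shows "int (x * (p - x) + y * (q - y)) \<le>
      int (x + y - z) * (int p + 1 - int (x + y - z)) + int z * (int q - 1 - int z)"
    and "x + y = 1 \<Longrightarrow> int (x * (p - x) + y * (q - y)) <
      int (x + y - z) * (int p + 1 - int (x + y - z)) + int z * (int q - 1 - int z)"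
proof -
  define m where "m = (p - q + 3) div 2"
  define d D e where "d = int p - int q" and "D = int x - int y"
    and "e = int (x + y - z) - int z"
  have z: "z = min (q - 1) ((x + y + 1 - m) div 2)" by (simp add: z_def profile_def m_def)
  have zs: "z \<le> x + y" by (simp add: z_def profile_def)
  have e: "e = int x + int y - 2 * int z" using zs by (simp add: e_def)
  have m: "2 * int m \<le> d + 3" "d + 2 \<le> 2 * int m"
    using assms(2) by (auto simp: m_def d_def)
  have lhs: "2 * int (x * (p - x) + y * (q - y))
      = (int x + int y) * (int p + int q - (int x + int y)) + D * (d - D)"
    using two_class_value[of "int x" "int p" "int y" "int q"] assms
    by (simp add: of_nat_diff d_def D_def)
  have rhs: "2 * (int (x + y - z) * (int p + 1 - int (x + y - z)) + int z * (int q - 1 - int z))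
      = (int x + int y) * (int p + int q - (int x + int y)) + e * (d + 2 - e)"
    using two_class_value[of "int (x + y - z)" "int p + 1" "int z" "int q - 1"] zs
    by (simp add: of_nat_diff d_def e_def algebra_simps)
  \<comment> \<open>Twice the values are compared; the common term of both sides is kept opaque.\<close>
  have halve: "u \<le> w \<Longrightarrow> a \<le> b" "u < w \<Longrightarrow> a < b" if "2 * a = c + u" "2 * b = c + w"
    for a b c u w :: int using that by linarith+
  have "0 \<le> d" using assms(2) by (simp add: d_def)
  have "D * (d - D) \<le> e * (d + 2 - e)"
  proof -
    consider (l) "x + y \<le> m" | (mid) "m \<le> x + y" "x + y \<le> m + 2 * (q - 1)"
      | (r) "m + 2 * (q - 1) \<le> x + y" by linarith
    then show ?thesis
    proof cases
      case l
      then have "z = 0" by (auto simp: z)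
      then show ?thesis using l m \<open>0 \<le> d\<close> by (auto simp: e D_def intro!: parabola_mono)
    next
      case mid
      then have "z = (x + y + 1 - m) div 2" unfolding z by linarith
      then have "e = int m \<or> e = int m - 1" using mid e by auto
      then show ?thesis using m \<open>0 \<le> d\<close> by (intro parabola_middle) auto
    next
      case r
      then have "z = q - 1" unfolding z by linarith
      let ?s = "int p + int q - (int x + int y)"
      \<comment> \<open>Seen from the right end, the old difference is \<open>d - D\<close> and the new one \<open>d + 2 - e\<close>.\<close>
      have "(d - D) * (d - (d - D)) \<le> ?s * (d + 2 - ?s)"
        using r m \<open>0 \<le> d\<close> assms by (intro parabola_mono) (auto simp: d_def D_def)
      moreover have "e = d + 2 - ?s" using \<open>z = q - 1\<close> assms(3) by (simp add: e d_def)
      then have "e * (d + 2 - e) = ?s * (d + 2 - ?s)" by simp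
      ultimately show ?thesis by (simp add: mult.commute)
    qed
  qed
  then show "int (x * (p - x) + y * (q - y)) \<le>
      int (x + y - z) * (int p + 1 - int (x + y - z)) + int z * (int q - 1 - int z)"
    by (rule halve(1)[OF lhs rhs])
  assume one: "x + y = 1"
  have "1 \<le> m" using m \<open>0 \<le> d\<close> by linarith
  then have "z = 0" using one by (simp add: z)
  then have "e = 1" using one e by simp
  moreover have "D = 1 \<or> D = - 1" using one by (auto simp: D_def add_is_1)
  ultimately have "D * (d - D) < e * (d + 2 - e)" using \<open>0 \<le> d\<close> by auto
  then show "int (x * (p - x) + y * (q - y)) <
      int (x + y - z) * (int p + 1 - int (x + y - z)) + int z * (int q - 1 - int z)"
    by (rule halve(2)[OF lhs rhs])
qed

lemma card_split: "finite A \<Longrightarrow> card (A \<inter> {t..}) = card A - card (A \<inter> {..<t})"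
  for A :: "nat set"
proof -
  assume "finite A"
  moreover have "A \<inter> {t..} = A - A \<inter> {..<t}" by auto
  ultimately show ?thesis by (simp add: card_Diff_subset)
qed

lemma wiener_spread:
  assumes AB: "A \<subseteq> {1..n}" "B \<subseteq> {1..n}" "A \<inter> B = {}"
    and le: "card B \<le> card A" "1 \<le> card B"
  obtains A' B' where "A' \<inter> B' = {}" "A' \<union> B' = A \<union> B"
    "card A' = card A + 1" "card B' = card B - 1"
    "wiener (path_graph n) A + wiener (path_graph n) B
      < wiener (path_graph n) A' + wiener (path_graph n) B'"
proof -
  define p q where "p = card A" and "q = card B"
  define Y where "Y = A \<union> B"
  have fin: "finite A" "finite B" "finite Y"
    using AB finite_subset[of _ "{1..n}"] by (auto simp: Y_def)
  have "profile p q 0 = 0" by (auto simp: profile_def)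
  moreover have "profile p q (Suc s) = profile p q s \<or> profile p q (Suc s) = Suc (profile p q s)" for s
  proof -
    define h where "h = (s + 1 - (p - q + 3) div 2) div 2"
    have "(Suc s + 1 - m) div 2 = (s + 1 - m) div 2 \<or> (Suc s + 1 - m) div 2 = Suc ((s + 1 - m) div 2)"
      for m by presburger
    then have "(Suc s + 1 - (p - q + 3) div 2) div 2 \<in> {h, Suc h}" by (simp add: h_def)
    then show ?thesis unfolding profile_def h_def[symmetric] by auto
  qed
  ultimately obtain B' where B': "B' \<subseteq> Y"
      "\<And>t. card (B' \<inter> {..<t}) = profile p q (card (Y \<inter> {..<t}))"
    using realize_profile[of "profile p q" Y] by blast
  define A' where "A' = Y - B'"
  have fin': "finite A'" "finite B'" using fin B' finite_subset by (auto simp: A'_def)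
  have cardY: "card Y = p + q" using fin AB by (simp add: Y_def p_def q_def card_Un_disjoint)
  have below: "card (Y \<inter> {..<t}) = card (A \<inter> {..<t}) + card (B \<inter> {..<t})" for t
  proof -
    have "Y \<inter> {..<t} = (A \<inter> {..<t}) \<union> (B \<inter> {..<t})" by (auto simp: Y_def)
    then show ?thesis using fin AB(3) by (simp add: card_Un_disjoint disjoint_iff)
  qed
  have below': "card (A' \<inter> {..<t}) = card (Y \<inter> {..<t}) - card (B' \<inter> {..<t})" for t
  proof -
    have "A' \<inter> {..<t} = Y \<inter> {..<t} - B' \<inter> {..<t}" by (auto simp: A'_def)
    moreover have "card (Y \<inter> {..<t} - B' \<inter> {..<t}) = card (Y \<inter> {..<t}) - card (B' \<inter> {..<t})"
      using fin' B'(1) by (intro card_Diff_subset) auto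
    ultimately show ?thesis by simp
  qed
  have Yn: "Y \<subseteq> {1..n}" using AB by (auto simp: Y_def)
  have "B' \<inter> {..<Suc n} = B'" "Y \<inter> {..<Suc n} = Y" using Yn B' by auto
  then have "card B' = profile p q (p + q)" using B'(2)[of "Suc n"] cardY by simp
  also have "\<dots> = q - 1" using le by (auto simp: profile_def p_def q_def)
  finally have cB: "card B' = q - 1" .
  have "card A' = p + q - (q - 1)" using fin' B' cB cardY by (simp add: A'_def card_Diff_subset)
  then have cA: "card A' = p + 1" using le by (simp add: q_def)
  have old: "cut A t + cut B t = card (A \<inter> {..<t}) * (p - card (A \<inter> {..<t}))
      + card (B \<inter> {..<t}) * (q - card (B \<inter> {..<t}))" for t
    using fin by (simp add: cut_def card_split p_def q_def)
  have new: "int (cut A' t + cut B' t) = int (card (A' \<inter> {..<t})) * (int p + 1 - int (card (A' \<inter> {..<t})))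
      + int (card (B' \<inter> {..<t})) * (int q - 1 - int (card (B' \<inter> {..<t})))" for t
  proof -
    have "card (A' \<inter> {..<t}) \<le> p + 1" "card (B' \<inter> {..<t}) \<le> q - 1"
      using fin' cA cB by (metis card_mono inf_le1)+
    then have "int (p + 1 - card (A' \<inter> {..<t})) = int p + 1 - int (card (A' \<inter> {..<t}))"
      "int (q - 1 - card (B' \<inter> {..<t})) = int q - 1 - int (card (B' \<inter> {..<t}))"
      using le(2) unfolding q_def[symmetric] by linarith+
    then show ?thesis using fin' by (simp only: cut_def card_split cA cB of_nat_add of_nat_mult)
  qed
  have sizes: "card (A \<inter> {..<t}) \<le> p" "card (B \<inter> {..<t}) \<le> q" for t
    using fin by (auto simp: p_def q_def intro: card_mono)
  have cut_le: "cut A t + cut B t \<le> cut A' t + cut B' t" for t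
    using cut_profile(1)[of q p "card (A \<inter> {..<t})" "card (B \<inter> {..<t})"] le sizes[of t]
    unfolding old[symmetric] below[symmetric] below'[symmetric] B'(2)[symmetric] new[symmetric]
    by (simp add: p_def q_def)
  have "Y \<noteq> {}" using cardY le by (auto simp: q_def)
  \<comment> \<open>Strictness comes from the cut just after the first vertex of the union.\<close>
  define t0 where "t0 = Suc (Min Y)"
  have "Min Y \<in> Y" using fin \<open>Y \<noteq> {}\<close> by simp
  then have "t0 \<le> Suc n" using Yn by (auto simp: t0_def)
  have "Y \<inter> {..<t0} = {Min Y}"
    using fin \<open>Min Y \<in> Y\<close> by (auto simp: t0_def less_Suc_eq_le intro: antisym)
  then have one: "card (Y \<inter> {..<t0}) = 1" by simp
  have t0: "t0 \<le> n"
  proof (rule ccontr)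
    assume "\<not> t0 \<le> n"
    then have "Y \<inter> {..<t0} = Y" using Yn by auto
    then show False using one cardY le by (simp add: p_def q_def)
  qed
  have cut_less: "cut A t0 + cut B t0 < cut A' t0 + cut B' t0"
    using cut_profile(2)[of q p "card (A \<inter> {..<t0})" "card (B \<inter> {..<t0})"] le sizes[of t0] one
    unfolding old[symmetric] below[symmetric] below'[symmetric] B'(2)[symmetric] new[symmetric]
    by (simp add: p_def q_def)
  have "(\<Sum>t\<le>n. cut A t + cut B t) < (\<Sum>t\<le>n. cut A' t + cut B' t)"
    by (rule sum_strict_mono_ex1) (use cut_le cut_less t0 in auto)
  moreover have "A' \<subseteq> {1..n}" "B' \<subseteq> {1..n}" using Yn B' by (auto simp: A'_def)
  ultimately have "wiener (path_graph n) A + wiener (path_graph n) B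
      < wiener (path_graph n) A' + wiener (path_graph n) B'"
    using AB by (simp add: wiener_path_cuts sum.distrib flip: of_nat_add of_nat_sum)
  moreover have "A' \<inter> B' = {}" "A' \<union> B' = A \<union> B" using B' by (auto simp: A'_def Y_def)
  ultimately show thesis using that cA cB by (simp add: p_def q_def)
qed


section \<open>Colorings and their types\<close>

lemma surj_colorings_iff:
  "f \<in> surj_colorings k G \<longleftrightarrow>
     f \<in> colorings k G \<and> (\<forall>i \<in> {1..k}. color_class G f i \<noteq> {})"
proof -
  have "f ` pverts G = {1..k} \<longleftrightarrow> (\<forall>i \<in> {1..k}. color_class G f i \<noteq> {})"
    if "f \<in> colorings k G"
  proof -
    have "f ` pverts G \<subseteq> {1..k}" using that by (auto simp: colorings_def)
    then have "f ` pverts G = {1..k} \<longleftrightarrow> {1..k} \<subseteq> f ` pverts G" by blast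
    also have "\<dots> \<longleftrightarrow> (\<forall>i \<in> {1..k}. color_class G f i \<noteq> {})"
      unfolding color_class_def subset_iff image_iff Ball_def by fastforce
    finally show ?thesis .
  qed
  then show ?thesis unfolding surj_colorings_def by blast
qed

lemma coloring_type_eq_iff:
  "coloring_type k G f = coloring_type k G g \<longleftrightarrow>
     image_mset (\<lambda>i. card (color_class G f i)) (mset_set {1..k})
       = image_mset (\<lambda>i. card (color_class G g i)) (mset_set {1..k})"
proof -
  have "mset (map a [1..<Suc k]) = image_mset a (mset_set {1..k})" for a :: "nat \<Rightarrow> nat"
    by (simp add: atLeastLessThanSuc_atLeastAtMost del: upt_Suc)
  moreover have "sort xs = sort ys \<longleftrightarrow> mset xs = mset ys" for xs ys :: "nat list"
    by (metis mset_sort properties_for_sort sorted_sort)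
  ultimately show ?thesis by (simp add: coloring_type_def)
qed

lemma sum_card_color_class:
  assumes "finite (pverts G)" "f \<in> colorings k G"
  shows "(\<Sum>i \<in> {1..k}. card (color_class G f i)) = card (pverts G)"
proof -
  have "(\<Union>i\<in>{1..k}. color_class G f i) = pverts G"
    using assms(2) by (auto simp: colorings_def color_class_def)
  moreover have "card (\<Union>i\<in>{1..k}. color_class G f i) = (\<Sum>i \<in> {1..k}. card (color_class G f i))"
    by (rule card_UN_disjoint) (use assms(1) in \<open>auto simp: color_class_def\<close>)
  ultimately show ?thesis by simp
qed

lemma recolor_two_classes:
  assumes f: "f \<in> surj_colorings k G" and ij: "i \<in> {1..k}" "j \<in> {1..k}" "i \<noteq> j"
    and AB: "A \<inter> B = {}" "A \<union> B = color_class G f i \<union> color_class G f j" "A \<noteq> {}" "B \<noteq> {}"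
  obtains g where "g \<in> surj_colorings k G" "color_class G g i = A" "color_class G g j = B"
    "\<forall>l. l \<noteq> i \<longrightarrow> l \<noteq> j \<longrightarrow> color_class G g l = color_class G f l"
proof -
  define g where "g v = (if v \<in> A then i else if v \<in> B then j else f v)" for v
  have "v \<in> A \<or> v \<in> B \<longleftrightarrow> v \<in> pverts G \<and> (f v = i \<or> f v = j)" for v
    using AB(2) by (auto simp: color_class_def)
  then have cl: "color_class G g i = A" "color_class G g j = B"
      "\<forall>l. l \<noteq> i \<longrightarrow> l \<noteq> j \<longrightarrow> color_class G g l = color_class G f l"
    and "g \<in> colorings k G"
    using AB(1) ij f
    by (auto simp: g_def color_class_def surj_colorings_def colorings_def PiE_iff extensional_def)
  have "color_class G g l \<noteq> {}" if "l \<in> {1..k}" for l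
    using that cl AB f by (cases "l = i"; cases "l = j") (auto simp: surj_colorings_iff)
  with \<open>g \<in> colorings k G\<close> have "g \<in> surj_colorings k G" by (simp add: surj_colorings_iff)
  then show thesis using that cl by blast
qed

lemma weak_maximizer_exists:
  assumes "finite (pverts G)" "f \<in> surj_colorings k G"
  obtains g where "g \<in> weak_maximizers k G" "coloring_type k G g = coloring_type k G f"
    "coloring_wiener k G f \<le> coloring_wiener k G g"
proof -
  let ?S = "{g \<in> surj_colorings k G. coloring_type k G g = coloring_type k G f}"
  have "finite ?S"
    using assms(1) by (simp add: surj_colorings_def colorings_def finite_PiE)
  then have fin: "finite (coloring_wiener k G ` ?S)" by (rule finite_imageI)
  have "f \<in> ?S" using assms(2) by simp
  then have "coloring_wiener k G ` ?S \<noteq> {}" by blast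
  then have "Max (coloring_wiener k G ` ?S) \<in> coloring_wiener k G ` ?S" by (rule Max_in[OF fin])
  then obtain g where g: "Max (coloring_wiener k G ` ?S) = coloring_wiener k G g" "g \<in> ?S"
    by (rule imageE)
  have "coloring_wiener k G h \<le> coloring_wiener k G g" if "h \<in> ?S" for h
    using Max_ge[OF fin imageI[OF that]] g(1) by simp
  then show thesis using that[of g] g(2) assms(2) by (auto simp: weak_maximizers_def)
qed

lemma weak_maximizers_wiener_eq:
  assumes "f \<in> weak_maximizers k G" "g \<in> weak_maximizers k G"
    and "coloring_type k G f = coloring_type k G g"
  shows "coloring_wiener k G f = coloring_wiener k G g"
  using assms by (auto simp: weak_maximizers_def intro!: antisym)

section \<open>Changing the type of a weak maximizer\<close>

lemma spread_coloring:
  assumes f: "f \<in> surj_colorings k (path_graph n)"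
    and ij: "i \<in> {1..k}" "j \<in> {1..k}" "i \<noteq> j"
    and le: "card (color_class (path_graph n) f j) \<le> card (color_class (path_graph n) f i)"
      "2 \<le> card (color_class (path_graph n) f j)"
  obtains g where "g \<in> surj_colorings k (path_graph n)"
    "card (color_class (path_graph n) g i) = card (color_class (path_graph n) f i) + 1"
    "card (color_class (path_graph n) g j) = card (color_class (path_graph n) f j) - 1"
    "\<forall>l. l \<noteq> i \<longrightarrow> l \<noteq> j \<longrightarrow>
       card (color_class (path_graph n) g l) = card (color_class (path_graph n) f l)"
    "coloring_wiener k (path_graph n) f < coloring_wiener k (path_graph n) g"
proof -
  let ?G = "path_graph n"
  let ?A = "color_class ?G f i" and ?B = "color_class ?G f j"
  have cls: "?A \<subseteq> {1..n}" "?B \<subseteq> {1..n}" "?A \<inter> ?B = {}" "1 \<le> card ?B"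
    using ij le by (auto simp: color_class_def)
  obtain A B where AB: "A \<inter> B = {}" "A \<union> B = ?A \<union> ?B"
      "card A = card ?A + 1" "card B = card ?B - 1"
      "wiener ?G ?A + wiener ?G ?B < wiener ?G A + wiener ?G B"
    by (rule wiener_spread[OF cls(1-3) le(1) cls(4)])
  have ne: "A \<noteq> {}" "B \<noteq> {}" using AB(3,4) le by auto
  obtain g where g: "g \<in> surj_colorings k ?G" "color_class ?G g i = A" "color_class ?G g j = B"
      "\<forall>l. l \<noteq> i \<longrightarrow> l \<noteq> j \<longrightarrow> color_class ?G g l = color_class ?G f l"
    by (rule recolor_two_classes[OF f ij AB(1,2) ne])
  have split: "coloring_wiener k ?G h = wiener ?G (color_class ?G h i) + wiener ?G (color_class ?G h j)
      + (\<Sum>l\<in>{1..k} - {i} - {j}. wiener ?G (color_class ?G h l))" for h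
    using ij sum.remove[of "{1..k}" i "\<lambda>l. wiener ?G (color_class ?G h l)"]
      sum.remove[of "{1..k} - {i}" j "\<lambda>l. wiener ?G (color_class ?G h l)"]
    by (simp add: coloring_wiener_def)
  have "(\<Sum>l\<in>{1..k} - {i} - {j}. wiener ?G (color_class ?G g l))
      = (\<Sum>l\<in>{1..k} - {i} - {j}. wiener ?G (color_class ?G f l))"
    using g(4) by (intro sum.cong) auto
  then have "coloring_wiener k ?G f < coloring_wiener k ?G g"
    using AB(5) by (simp add: split g(2,3))
  then show thesis using that[of g] g AB by simp
qed

lemma spread_increases_wiener:
  assumes "f \<in> weak_maximizers k (path_graph n)"
    and "i \<in> {1..k}" "j \<in> {1..k}" "i \<noteq> j"
    and "2 \<le> card (color_class (path_graph n) f i)" "2 \<le> card (color_class (path_graph n) f j)"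
  obtains g where "g \<in> weak_maximizers k (path_graph n)"
    "coloring_wiener k (path_graph n) f < coloring_wiener k (path_graph n) g"
proof -
  let ?G = "path_graph n"
  have f: "f \<in> surj_colorings k ?G" using assms(1) by (simp add: weak_maximizers_def)
  obtain h where h: "h \<in> surj_colorings k ?G" "coloring_wiener k ?G f < coloring_wiener k ?G h"
  proof (cases "card (color_class ?G f j) \<le> card (color_class ?G f i)")
    case True
    show ?thesis by (rule spread_coloring[OF f assms(2,3,4) True assms(6)]) (rule that)
  next
    case False
    then have "card (color_class ?G f i) \<le> card (color_class ?G f j)" by simp
    from spread_coloring[OF f assms(3,2) assms(4)[symmetric] this assms(5)]
    show ?thesis using that by metis
  qed
  have "finite (pverts ?G)" by simp
  then obtain g where "g \<in> weak_maximizers k ?G" "coloring_wiener k ?G h \<le> coloring_wiener k ?G g"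
    using h(1) by (rule weak_maximizer_exists)
  then show thesis using that[of g] h(2) by simp
qed

text \<open>
  Moving one vertex from class \<open>i\<close> to class \<open>j\<close> gives a new type. Take a weak maximizer
  \<open>g\<close> of that type. Since the gap is at least 2, class \<open>i\<close> is still not the smaller one of
  the two, so \<open>spread_coloring\<close> applies: spreading the two corresponding classes of \<open>g\<close> leads back to the type of
  \<open>f\<close> with a value strictly above that of \<open>g\<close>, and this value is at most that of \<open>f\<close>
  by the maximality of \<open>f\<close>.
\<close>

lemma level_decreases_wiener:
  assumes f: "f \<in> weak_maximizers k (path_graph n)"
    and ij: "i \<in> {1..k}" "j \<in> {1..k}"
    and gap: "card (color_class (path_graph n) f j) + 2 \<le> card (color_class (path_graph n) f i)"
  obtains g where "g \<in> weak_maximizers k (path_graph n)"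
    "coloring_wiener k (path_graph n) g < coloring_wiener k (path_graph n) f"
proof -
  let ?G = "path_graph n"
  let ?A = "color_class ?G f i" and ?B = "color_class ?G f j"
  have surj: "f \<in> surj_colorings k ?G" using f by (simp add: weak_maximizers_def)
  have fin: "finite ?A" "finite ?B" by (auto simp: color_class_def)
  have "?B \<noteq> {}" using surj ij(2) by (simp add: surj_colorings_iff)
  then have B1: "1 \<le> card ?B" using fin by (simp add: Suc_le_eq card_gt_0_iff)
  have "i \<noteq> j" using gap by auto
  have "?A \<noteq> {}" using gap by auto
  then obtain v where v: "v \<in> ?A" by blast
  have vB: "v \<notin> ?B" using v \<open>i \<noteq> j\<close> by (auto simp: color_class_def)
  have cA: "card (?A - {v}) = card ?A - 1" using v fin by simp
  have cB: "card (insert v ?B) = card ?B + 1" using vB fin by simp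
  have 1: "(?A - {v}) \<inter> insert v ?B = {}" "(?A - {v}) \<union> insert v ?B = ?A \<union> ?B"
    using v \<open>i \<noteq> j\<close> by (auto simp: color_class_def)
  have "card (?A - {v}) \<noteq> 0" using cA gap by simp
  then have ne: "?A - {v} \<noteq> {}" "insert v ?B \<noteq> {}" by (metis card.empty, simp)
  obtain h where h: "h \<in> surj_colorings k ?G" "color_class ?G h i = ?A - {v}"
      "color_class ?G h j = insert v ?B"
      "\<forall>l. l \<noteq> i \<longrightarrow> l \<noteq> j \<longrightarrow> color_class ?G h l = color_class ?G f l"
    by (rule recolor_two_classes[OF surj ij \<open>i \<noteq> j\<close> 1 ne])
  have "finite (pverts ?G)" by simp
  then obtain g where g: "g \<in> weak_maximizers k ?G" "coloring_type k ?G g = coloring_type k ?G h"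
    using h(1) by (rule weak_maximizer_exists)
  \<comment> \<open>Equal types only match the class sizes of \<open>g\<close> and \<open>h\<close> up to a permutation of the colors.\<close>
  have "finite {1..k}" by simp
  then obtain \<pi> where \<pi>: "\<pi> permutes {1..k}"
      "\<forall>l\<in>{1..k}. card (color_class ?G h l) = card (color_class ?G g (\<pi> l))"
    using g(2)[symmetric] unfolding coloring_type_eq_iff
    by (rule image_mset_eq_implies_permutes)
  have ci: "card (color_class ?G g (\<pi> i)) = card ?A - 1"
    and cj: "card (color_class ?G g (\<pi> j)) = card ?B + 1"
    using bspec[OF \<pi>(2) ij(1)] bspec[OF \<pi>(2) ij(2)] h(2,3) cA cB by simp_all
  have gs: "g \<in> surj_colorings k ?G" using g(1) by (simp add: weak_maximizers_def)
  have \<pi>k: "\<pi> i \<in> {1..k}" "\<pi> j \<in> {1..k}"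
    using permutes_in_image[OF \<pi>(1)] ij by blast+
  have inj: "\<pi> l = \<pi> l' \<longleftrightarrow> l = l'" for l l'
    using permutes_inj[OF \<pi>(1)] by (simp add: inj_eq)
  have spread: "\<pi> i \<noteq> \<pi> j" "card (color_class ?G g (\<pi> j)) \<le> card (color_class ?G g (\<pi> i))"
      "2 \<le> card (color_class ?G g (\<pi> j))"
    using ci cj gap B1 \<open>i \<noteq> j\<close> by (auto simp: inj)
  obtain g' where g': "g' \<in> surj_colorings k ?G"
      "card (color_class ?G g' (\<pi> i)) = card (color_class ?G g (\<pi> i)) + 1"
      "card (color_class ?G g' (\<pi> j)) = card (color_class ?G g (\<pi> j)) - 1"
      "\<forall>l. l \<noteq> \<pi> i \<longrightarrow> l \<noteq> \<pi> j \<longrightarrow> card (color_class ?G g' l) = card (color_class ?G g l)"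
      "coloring_wiener k ?G g < coloring_wiener k ?G g'"
    by (rule spread_coloring[OF gs \<pi>k spread])
  have "card (color_class ?G g' (\<pi> i)) = card ?A" "card (color_class ?G g' (\<pi> j)) = card ?B"
    using g'(2,3) ci cj gap by auto
  then have "card (color_class ?G f l) = card (color_class ?G g' (\<pi> l))" if "l \<in> {1..k}" for l
    using bspec[OF \<pi>(2) that] g'(4) h(4) by (cases "l = i"; cases "l = j") (auto simp: inj)
  then have "image_mset (\<lambda>l. card (color_class ?G f l)) (mset_set {1..k})
      = image_mset ((\<lambda>l. card (color_class ?G g' l)) \<circ> \<pi>) (mset_set {1..k})"
    by (intro image_mset_cong) simp
  also have "\<dots> = image_mset (\<lambda>l. card (color_class ?G g' l)) (mset_set {1..k})"
    by (simp only: image_mset.compositionality[symmetric] image_mset_mset_set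
        permutes_inj_on[OF \<pi>(1)] permutes_image[OF \<pi>(1)])
  finally have "coloring_type k ?G f = coloring_type k ?G g'"
    by (simp add: coloring_type_eq_iff)
  then have "coloring_wiener k ?G g' \<le> coloring_wiener k ?G f"
    using f g'(1) by (simp add: weak_maximizers_def)
  then show thesis using that[of g] g(1) g'(5) by simp
qed

section \<open>Balanced and concentrated types\<close>

text \<open>
  Sizes that differ by at most one are a minimum \<open>c\<close> and \<open>c + 1\<close>, with \<open>c\<close>
  attained; so \<open>c\<close> and the number of larger ones are quotient and remainder of their sum, and
  the multiset of sizes is determined by the sum and the number of classes.
\<close>

lemma balanced_image_mset:
  fixes a :: "'a \<Rightarrow> nat"
  assumes "finite I" "I \<noteq> {}" "\<And>i j. i \<in> I \<Longrightarrow> j \<in> I \<Longrightarrow> a i \<le> a j + 1"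
  shows "image_mset a (mset_set I) =
      replicate_mset (sum a I mod card I) (sum a I div card I + 1)
      + replicate_mset (card I - sum a I mod card I) (sum a I div card I)"
proof -
  define c where "c = Min (a ` I)"
  define J where "J = {i \<in> I. a i = c + 1}"
  have "c \<in> a ` I" unfolding c_def using assms(1,2) by (intro Min_in) auto
  then obtain i0 where i0: "i0 \<in> I" "a i0 = c" by auto
  have vals: "a i = c + (if i \<in> J then 1 else 0)" if "i \<in> I" for i
  proof -
    have "c \<le> a i" using that assms by (simp add: c_def)
    moreover have "a i \<le> c + 1" using assms(3)[OF that i0(1)] i0(2) by simp
    ultimately show ?thesis using that by (auto simp: J_def)
  qed
  have J: "J \<subseteq> I" "finite J" "i0 \<notin> J" using assms(1) i0 by (auto simp: J_def)
  have lt: "card J < card I" using J i0 assms(1) by (intro psubset_card_mono) auto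
  have "sum a I = (\<Sum>i\<in>I. c + (if i \<in> J then 1 else 0))" using vals by (intro sum.cong) auto
  also have "\<dots> = card I * c + card J"
    using J assms(1) by (simp add: sum.distrib sum.If_cases Int_absorb1)
  finally have "sum a I div card I = c" "sum a I mod card I = card J" using lt by auto
  moreover have "image_mset a (mset_set I) = image_mset a (mset_set J) + image_mset a (mset_set (I - J))"
    using J assms(1) mset_set_Union[of J "I - J"] by (simp add: Un_absorb1)
  moreover have "image_mset a (mset_set J) = replicate_mset (card J) (c + 1)"
    using J by (subst image_mset_cong[of _ a "\<lambda>_. c + 1"]) (auto simp: J_def image_mset_const_eq)
  moreover have "image_mset a (mset_set (I - J)) = replicate_mset (card I - card J) c"
    using J assms(1) vals
    by (subst image_mset_cong[of _ a "\<lambda>_. c"]) (auto simp: image_mset_const_eq card_Diff_subset)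
  ultimately show ?thesis by simp
qed

text \<open>
  If one of the positive sizes has the largest value that the sum admits, nothing more than 1 is left
  for each of the others.
\<close>

lemma concentrated_image_mset:
  fixes a :: "'a \<Rightarrow> nat"
  assumes "finite I" "i \<in> I" "\<And>l. l \<in> I \<Longrightarrow> 1 \<le> a l" "a i = sum a I - (card I - 1)"
  shows "image_mset a (mset_set I)
    = add_mset (sum a I - (card I - 1)) (replicate_mset (card I - 1) 1)"
proof -
  have "card I - 1 = (\<Sum>l\<in>I - {i}. 1)" using assms by simp
  also have le: "\<dots> \<le> sum a (I - {i})" using assms(3) by (intro sum_mono) auto
  finally have ge: "card I - 1 \<le> sum a (I - {i})" .
  have "sum a I = a i + sum a (I - {i})" using assms by (simp add: sum.remove)
  with ge assms(4) assms(3)[OF assms(2)] have eq: "(\<Sum>l\<in>I - {i}. 1) = sum a (I - {i})"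
    using assms(1,2) by simp
  have one: "a l = 1" if "l \<in> I - {i}" for l
    using sum_mono_inv[OF eq, of l] that assms(1,3) by auto
  have "image_mset a (mset_set I) = add_mset (a i) (image_mset a (mset_set (I - {i})))"
    using assms(1,2) by (simp add: mset_set.remove)
  also have "image_mset a (mset_set (I - {i})) = image_mset (\<lambda>_. 1) (mset_set (I - {i}))"
    using one assms(1) by (intro image_mset_cong) auto
  finally show ?thesis using assms by (simp add: image_mset_const_eq)
qed

lemma concentrated_if_at_most_one_large:
  fixes a :: "'a \<Rightarrow> nat"
  assumes "finite I" "I \<noteq> {}" "\<And>l. l \<in> I \<Longrightarrow> 1 \<le> a l"
    and "\<And>i j. i \<in> I \<Longrightarrow> j \<in> I \<Longrightarrow> i \<noteq> j \<Longrightarrow> a i < 2 \<or> a j < 2"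
  shows "\<exists>i\<in>I. a i = sum a I - (card I - 1)"
proof -
  obtain i where i: "i \<in> I" "\<And>l. l \<in> I - {i} \<Longrightarrow> a l < 2"
    using assms(2,4) by (metis Diff_iff all_not_in_conv insertI1)
  have "a l = 1" if "l \<in> I - {i}" for l
    using i(2)[OF that] assms(3)[of l] that by auto
  then have "sum a (I - {i}) = card I - 1" using i(1) assms(1) by simp
  then have "a i = sum a I - (card I - 1)" using i(1) assms(1) by (simp add: sum.remove)
  then show ?thesis using i(1) by blast
qed


section \<open>Extreme values of weak maximizers\<close>

theorem corollary4p5:
  fixes n k :: nat and f :: "nat \<Rightarrow> nat"
  assumes "2 \<le> k" and "k \<le> n"
    and "f \<in> weak_maximizers k (path_graph n)"
  shows "(coloring_wiener k (path_graph n) f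
            = Min (coloring_wiener k (path_graph n) ` weak_maximizers k (path_graph n))
          \<longleftrightarrow> (\<forall>i \<in> {1..k}. \<forall>j \<in> {1..k}.
                \<bar>int (card (color_class (path_graph n) f i))
                  - int (card (color_class (path_graph n) f j))\<bar> \<le> 1))
       \<and> (coloring_wiener k (path_graph n) f
            = Max (coloring_wiener k (path_graph n) ` weak_maximizers k (path_graph n))
          \<longleftrightarrow> (\<exists>i \<in> {1..k}. card (color_class (path_graph n) f i) = n - (k - 1)))"
proof -
  let ?G = "path_graph n"
  let ?W = "coloring_wiener k ?G" and ?M = "weak_maximizers k ?G"
  let ?s = "\<lambda>g i. card (color_class ?G g i)"
  define balanced where "balanced g \<longleftrightarrow> (\<forall>i\<in>{1..k}. \<forall>j\<in>{1..k}. \<bar>int (?s g i) - int (?s g j)\<bar> \<le> 1)" for g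
  define concentrated where "concentrated g \<longleftrightarrow> (\<exists>i\<in>{1..k}. ?s g i = n - (k - 1))" for g
  have fin: "finite (?W ` ?M)" and ne: "?W ` ?M \<noteq> {}"
    using finite_weak_maximizers[of ?G k] assms(3) by auto
  have I: "finite {1..k}" "{1..k} \<noteq> {}" using assms(1) by auto
  have surj: "g \<in> surj_colorings k ?G" if "g \<in> ?M" for g
    using that by (simp add: weak_maximizers_def)
  have total: "sum (?s g) {1..k} = n" if "g \<in> ?M" for g
    using sum_card_color_class[of ?G g k] surj[OF that] by (simp add: surj_colorings_def)
  have pos: "1 \<le> ?s g l" if "g \<in> ?M" "l \<in> {1..k}" for g l
  proof -
    have "color_class ?G g l \<noteq> {}" using surj[OF that(1)] that(2) by (simp add: surj_colorings_iff)
    moreover have "finite (color_class ?G g l)" by (auto simp: color_class_def)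
    ultimately show ?thesis by (simp add: Suc_le_eq card_gt_0_iff)
  qed
  have balanced_eq: "?W g = ?W h" if "g \<in> ?M" "h \<in> ?M" "balanced g" "balanced h" for g h
  proof -
    have "?s g i \<le> ?s g j + 1" "?s h i \<le> ?s h j + 1" if "i \<in> {1..k}" "j \<in> {1..k}" for i j
      using that \<open>balanced g\<close> \<open>balanced h\<close> unfolding balanced_def by fastforce+
    then have "coloring_type k ?G g = coloring_type k ?G h"
      using balanced_image_mset[OF I, of "?s g"] balanced_image_mset[OF I, of "?s h"]
        total[OF that(1)] total[OF that(2)]
      unfolding coloring_type_eq_iff by metis
    then show ?thesis using that weak_maximizers_wiener_eq by blast
  qed
  have concentrated_eq: "?W g = ?W h" if "g \<in> ?M" "h \<in> ?M" "concentrated g" "concentrated h" for g h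
  proof -
    have "image_mset (?s g') (mset_set {1..k}) = add_mset (n - (k - 1)) (replicate_mset (k - 1) 1)"
      if "g' \<in> ?M" "concentrated g'" for g'
      using concentrated_image_mset[of "{1..k}" _ "?s g'"] that total[OF that(1)] pos[OF that(1)]
      unfolding concentrated_def by auto
    then have "coloring_type k ?G g = coloring_type k ?G h"
      using that unfolding coloring_type_eq_iff by metis
    then show ?thesis using that weak_maximizers_wiener_eq by blast
  qed
  have minimal_balanced: "balanced g" if g: "g \<in> ?M" "?W g = Min (?W ` ?M)" for g
  proof (rule ccontr)
    assume "\<not> balanced g"
    then obtain i j where ij: "i \<in> {1..k}" "j \<in> {1..k}" "\<not> \<bar>int (?s g i) - int (?s g j)\<bar> \<le> 1"
      unfolding balanced_def by blast
    then have "?s g j + 2 \<le> ?s g i \<or> ?s g i + 2 \<le> ?s g j" by linarith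
    then obtain h where "h \<in> ?M" "?W h < ?W g"
      using level_decreases_wiener[OF g(1) ij(1,2)] level_decreases_wiener[OF g(1) ij(2,1)] by metis
    then show False using Min_le[OF fin, of "?W h"] g(2) by simp
  qed
  have maximal_concentrated: "concentrated g" if g: "g \<in> ?M" "?W g = Max (?W ` ?M)" for g
  proof (rule ccontr)
    assume "\<not> concentrated g"
    then have "\<not> (\<exists>i\<in>{1..k}. ?s g i = sum (?s g) {1..k} - (card {1..k} - 1))"
      using total[OF g(1)] by (simp add: concentrated_def)
    then obtain i j where ij: "i \<in> {1..k}" "j \<in> {1..k}" "i \<noteq> j" "2 \<le> ?s g i" "2 \<le> ?s g j"
      using concentrated_if_at_most_one_large[OF I, of "?s g"] pos[OF g(1)] by (meson not_le)
    obtain h where "h \<in> ?M" "?W g < ?W h" by (rule spread_increases_wiener[OF g(1) ij])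
    then show False using Max_ge[OF fin, of "?W h"] g(2) by simp
  qed
  have "?W f = Min (?W ` ?M) \<longleftrightarrow> balanced f"
  proof
    assume "?W f = Min (?W ` ?M)"
    then show "balanced f" using minimal_balanced[OF assms(3)] by simp
  next
    assume f: "balanced f"
    obtain g where g: "g \<in> ?M" "Min (?W ` ?M) = ?W g" using Min_in[OF fin ne] by blast
    have "balanced g" using minimal_balanced[OF g(1)] g(2) by simp
    then show "?W f = Min (?W ` ?M)" using balanced_eq[OF assms(3) g(1) f \<open>balanced g\<close>] g(2) by simp
  qed
  moreover have "?W f = Max (?W ` ?M) \<longleftrightarrow> concentrated f"
  proof
    assume "?W f = Max (?W ` ?M)"
    then show "concentrated f" using maximal_concentrated[OF assms(3)] by simp
  next
    assume f: "concentrated f"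
    obtain g where g: "g \<in> ?M" "Max (?W ` ?M) = ?W g" using Max_in[OF fin ne] by blast
    have "concentrated g" using maximal_concentrated[OF g(1)] g(2) by simp
    then show "?W f = Max (?W ` ?M)" using concentrated_eq[OF assms(3) g(1) f \<open>concentrated g\<close>] g(2) by simp
  qed
  ultimately show ?thesis unfolding balanced_def concentrated_def by blast
qed

end
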